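(* HyperQCTL$^*$ is strictly more expressive than MPL$[E]$: every MPL$[E]$ sentence has an equivalent HyperQCTL$^*$ formula (satisfied by the same $AP$-labeled trees), and some HyperQCTL$^*$ formula has no equivalent MPL$[E]$ sentence.
   Context: A tree is a partially ordered infinite set of nodes $S$ with a least element (root) such that each node's ancestors are totally ordered; $s'$ is the direct ancestor of $s$ if $s'<s$ with nothing strictly between. An $AP$-labeled tree has $L:S\to2^{AP}$. A path is an infinite sequence $s_0s_1\dots$ with $s_i$ the direct ancestor of $s_{i+1}$; $Paths(\mathcal T)$ are the paths from the root; $p[0,i]$ is the prefix up to $i$. HyperCTL$^*$ syntax: $\varphi ::= a_\pi\mid\neg\varphi\mid\varphi\vee\varphi\mid\mathsf X\varphi\mid\varphi\mathsf U\varphi\mid\exists\pi.\varphi$, semantics under a path assignment $\Pi$ and position $i$: $a_\pi$ holds iff $a\in L(\Pi(\pi)[i])$; Boolean, $\mathsf X$, $\mathsf U$ as in LTL over positions; $\Pi,i\models\exists\pi.\varphi$ iff some $p\in Paths(\mathcal T)$ with $p[0,i]=\Pi(\varepsilon)[0,i]$ ($\varepsilon$ the most recently quantified path; no constraint if none) satisfies $\Pi[\pi\mapsto p,\varepsilon\mapsto p],i\models\varphi$. HyperQCTL$^*$ extends HyperCTL$^*$ with atoms $q_\pi$ and propositional quantification $\exists q.\varphi$ (and its dual $\forall q$): $\Pi,i\models_{\mathcal T}\exists q.\varphi$ iff there is a labeling $L':S\to2^{AP\cup\{q\}}$ agreeing with $L$ on $AP\setminus\{q\}$ at every node such that $\Pi,i\models\varphi$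 in the tree relabeled by $L'$. $\mathcal T\models\varphi$ iff $\emptyset,0\models_{\mathcal T}\varphi$. MPL$[E]$: formulas from $P_a(x)$, $x<y$, $x=y$, $E(x,y)$, $x\in X$ with $\neg,\vee,\exists x,\exists X$ over an $AP$-labeled tree: first-order variables range over nodes, $P_a(x)$ iff $a\in L(x)$, $x<y$ iff $x$ is an ancestor of $y$, $E(x,y)$ iff $x,y$ have the same number of ancestors; second-order variables range only over sets of nodes forming exactly one path of the tree.
   Formalization: Trees are required to have every node on an infinite path from the root (with dead ends the first half is false); the equivalent HyperQCTL* formula is stated for trees with nodes in one arbitrary infinite set, uniformity over all trees following by a cardinality argument. *)

theory Defs
  imports Main "HOL-Library.Equipollence"
begin

section \<open>Labeled trees\<close>

text \<open>The set of atomic propositions is a component of the tree, because propositional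
  quantification turns an \<open>AP\<close>-labeled tree into an \<open>AP \<union> {q}\<close>-labeled one.\<close>

record ('s, 'p) ltree =
  nodes :: "'s set"
  le_rel :: "('s \<times> 's) set"
  props :: "'p set"
  label :: "'s \<Rightarrow> 'p set"

definition ancestor :: "('s, 'p) ltree \<Rightarrow> 's \<Rightarrow> 's \<Rightarrow> bool" where
  "ancestor T x y \<longleftrightarrow> (x, y) \<in> le_rel T \<and> x \<noteq> y"

definition ancestors :: "('s, 'p) ltree \<Rightarrow> 's \<Rightarrow> 's set" where
  "ancestors T s = {x \<in> nodes T. ancestor T x s}"

definition direct_ancestor :: "('s, 'p) ltree \<Rightarrow> 's \<Rightarrow> 's \<Rightarrow> bool" where
  "direct_ancestor T x y \<longleftrightarrow>
     ancestor T x y \<and> \<not> (\<exists>z \<in> nodes T. ancestor T x z \<and> ancestor T z y)"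

definition is_root :: "('s, 'p) ltree \<Rightarrow> 's \<Rightarrow> bool" where
  "is_root T r \<longleftrightarrow> r \<in> nodes T \<and> (\<forall>s \<in> nodes T. (r, s) \<in> le_rel T)"

definition is_tree :: "('s, 'p) ltree \<Rightarrow> bool" where
  "is_tree T \<longleftrightarrow>
     infinite (nodes T) \<and>
     partial_order_on (nodes T) (le_rel T) \<and>
     (\<exists>r. is_root T r) \<and>
     (\<forall>s \<in> nodes T. total_on (ancestors T s) (le_rel T))"

definition labeled_tree :: "'p set \<Rightarrow> ('s, 'p) ltree \<Rightarrow> bool" where
  "labeled_tree AP T \<longleftrightarrow> is_tree T \<and> props T = AP \<and> (\<forall>s \<in> nodes T. label T s \<subseteq> AP)"

definition is_path :: "('s, 'p) ltree \<Rightarrow> (nat \<Rightarrow> 's) \<Rightarrow> bool" where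
  "is_path T p \<longleftrightarrow> (\<forall>i. p i \<in> nodes T \<and> direct_ancestor T (p i) (p (Suc i)))"

definition Paths :: "('s, 'p) ltree \<Rightarrow> (nat \<Rightarrow> 's) set" where
  "Paths T = {p. is_path T p \<and> is_root T (p 0)}"

text \<open>HyperQCTL* quantifies over \<^const>\<open>Paths\<close> only, so it cannot see a node that lies on no
  infinite path from the root (a dead end, or a node with infinitely many ancestors), whereas
  MPL[E] can. The two logics are compared on trees without such nodes, as obtained by
  unrolling a Kripke structure with a total transition relation.\<close>

definition all_nodes_on_paths :: "('s, 'p) ltree \<Rightarrow> bool" where
  "all_nodes_on_paths T \<longleftrightarrow> (\<forall>s \<in> nodes T. \<exists>p \<in> Paths T. s \<in> range p)"


section \<open>HyperQCTL*\<close>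

text \<open>Path variables are natural numbers.\<close>

datatype 'p hyperqctl =
    HAtom 'p nat
  | HNot "'p hyperqctl"
  | HOr "'p hyperqctl" "'p hyperqctl"
  | HNext "'p hyperqctl"
  | HUntil "'p hyperqctl" "'p hyperqctl"
  | HExPath nat "'p hyperqctl"
  | HExProp 'p "'p hyperqctl"

primrec h_path_vars :: "'p hyperqctl \<Rightarrow> nat set" \<comment> \<open>free ones\<close> where
  "h_path_vars (HAtom a x) = {x}"
| "h_path_vars (HNot \<phi>) = h_path_vars \<phi>"
| "h_path_vars (HOr \<phi> \<psi>) = h_path_vars \<phi> \<union> h_path_vars \<psi>"
| "h_path_vars (HNext \<phi>) = h_path_vars \<phi>"
| "h_path_vars (HUntil \<phi> \<psi>) = h_path_vars \<phi> \<union> h_path_vars \<psi>"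
| "h_path_vars (HExPath x \<phi>) = h_path_vars \<phi> - {x}"
| "h_path_vars (HExProp q \<phi>) = h_path_vars \<phi>"

primrec h_props :: "'p hyperqctl \<Rightarrow> 'p set" \<comment> \<open>free ones\<close> where
  "h_props (HAtom a x) = {a}"
| "h_props (HNot \<phi>) = h_props \<phi>"
| "h_props (HOr \<phi> \<psi>) = h_props \<phi> \<union> h_props \<psi>"
| "h_props (HNext \<phi>) = h_props \<phi>"
| "h_props (HUntil \<phi> \<psi>) = h_props \<phi> \<union> h_props \<psi>"
| "h_props (HExPath x \<phi>) = h_props \<phi>"
| "h_props (HExProp q \<phi>) = h_props \<phi> - {q}"

definition h_closed :: "'p set \<Rightarrow> 'p hyperqctl \<Rightarrow> bool" where
  "h_closed AP \<phi> \<longleftrightarrow> h_path_vars \<phi> = {} \<and> h_props \<phi> \<subseteq> AP"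

text \<open>The argument \<open>e\<close> is the most recently quantified path, if any; \<open>P\<close> is the path assignment.\<close>

primrec h_sat :: "'p hyperqctl \<Rightarrow> ('s, 'p) ltree \<Rightarrow> (nat \<rightharpoonup> (nat \<Rightarrow> 's)) \<Rightarrow>
    (nat \<Rightarrow> 's) option \<Rightarrow> nat \<Rightarrow> bool" where
  "h_sat (HAtom a x) T P e i \<longleftrightarrow> (\<exists>p. P x = Some p \<and> a \<in> label T (p i))"
| "h_sat (HNot \<phi>) T P e i \<longleftrightarrow> \<not> h_sat \<phi> T P e i"
| "h_sat (HOr \<phi> \<psi>) T P e i \<longleftrightarrow> h_sat \<phi> T P e i \<or> h_sat \<psi> T P e i"
| "h_sat (HNext \<phi>) T P e i \<longleftrightarrow> h_sat \<phi> T P e (Suc i)"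
| "h_sat (HUntil \<phi> \<psi>) T P e i \<longleftrightarrow>
     (\<exists>k \<ge> i. h_sat \<psi> T P e k \<and> (\<forall>j. i \<le> j \<and> j < k \<longrightarrow> h_sat \<phi> T P e j))"
| "h_sat (HExPath x \<phi>) T P e i \<longleftrightarrow>
     (\<exists>p \<in> Paths T. (\<forall>p'. e = Some p' \<longrightarrow> (\<forall>j \<le> i. p j = p' j)) \<and>
        h_sat \<phi> T (P(x \<mapsto> p)) (Some p) i)"
| "h_sat (HExProp q \<phi>) T P e i \<longleftrightarrow>
     (\<exists>L'. (\<forall>s \<in> nodes T. L' s \<subseteq> props T \<union> {q} \<and>
              L' s \<inter> (props T - {q}) = label T s \<inter> (props T - {q})) \<and>
        h_sat \<phi> (T\<lparr>props := props T \<union> {q}, label := L'\<rparr>) P e i)"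

definition h_models :: "('s, 'p) ltree \<Rightarrow> 'p hyperqctl \<Rightarrow> bool" where
  "h_models T \<phi> \<longleftrightarrow> h_sat \<phi> T Map.empty None 0"


section \<open>MPL[E]\<close>

text \<open>First-order and second-order variables are natural numbers, in separate name spaces.\<close>

datatype 'p mpl =
    MPred 'p nat
  | MLess nat nat
  | MEq nat nat
  | MLevel nat nat
  | MMem nat nat
  | MNot "'p mpl"
  | MOr "'p mpl" "'p mpl"
  | MExNode nat "'p mpl"
  | MExPath nat "'p mpl"

primrec m_fo_vars :: "'p mpl \<Rightarrow> nat set" \<comment> \<open>free ones\<close> where
  "m_fo_vars (MPred a x) = {x}"
| "m_fo_vars (MLess x y) = {x, y}"
| "m_fo_vars (MEq x y) = {x, y}"
| "m_fo_vars (MLevel x y) = {x, y}"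
| "m_fo_vars (MMem x X) = {x}"
| "m_fo_vars (MNot \<phi>) = m_fo_vars \<phi>"
| "m_fo_vars (MOr \<phi> \<psi>) = m_fo_vars \<phi> \<union> m_fo_vars \<psi>"
| "m_fo_vars (MExNode x \<phi>) = m_fo_vars \<phi> - {x}"
| "m_fo_vars (MExPath X \<phi>) = m_fo_vars \<phi>"

primrec m_so_vars :: "'p mpl \<Rightarrow> nat set" \<comment> \<open>free ones\<close> where
  "m_so_vars (MPred a x) = {}"
| "m_so_vars (MLess x y) = {}"
| "m_so_vars (MEq x y) = {}"
| "m_so_vars (MLevel x y) = {}"
| "m_so_vars (MMem x X) = {X}"
| "m_so_vars (MNot \<phi>) = m_so_vars \<phi>"
| "m_so_vars (MOr \<phi> \<psi>) = m_so_vars \<phi> \<union> m_so_vars \<psi>"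
| "m_so_vars (MExNode x \<phi>) = m_so_vars \<phi>"
| "m_so_vars (MExPath X \<phi>) = m_so_vars \<phi> - {X}"

primrec m_props :: "'p mpl \<Rightarrow> 'p set" where
  "m_props (MPred a x) = {a}"
| "m_props (MLess x y) = {}"
| "m_props (MEq x y) = {}"
| "m_props (MLevel x y) = {}"
| "m_props (MMem x X) = {}"
| "m_props (MNot \<phi>) = m_props \<phi>"
| "m_props (MOr \<phi> \<psi>) = m_props \<phi> \<union> m_props \<psi>"
| "m_props (MExNode x \<phi>) = m_props \<phi>"
| "m_props (MExPath X \<phi>) = m_props \<phi>"

definition m_sentence :: "'p set \<Rightarrow> 'p mpl \<Rightarrow> bool" where
  "m_sentence AP \<phi> \<longleftrightarrow> m_fo_vars \<phi> = {} \<and> m_so_vars \<phi> = {} \<and> m_props \<phi> \<subseteq> AP"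

primrec m_sat :: "'p mpl \<Rightarrow> ('s, 'p) ltree \<Rightarrow> (nat \<rightharpoonup> 's) \<Rightarrow> (nat \<rightharpoonup> 's set) \<Rightarrow> bool" where
  "m_sat (MPred a x) T v V \<longleftrightarrow> (\<exists>s. v x = Some s \<and> a \<in> label T s)"
| "m_sat (MLess x y) T v V \<longleftrightarrow> (\<exists>s t. v x = Some s \<and> v y = Some t \<and> ancestor T s t)"
| "m_sat (MEq x y) T v V \<longleftrightarrow> (\<exists>s t. v x = Some s \<and> v y = Some t \<and> s = t)"
| "m_sat (MLevel x y) T v V \<longleftrightarrow>
     (\<exists>s t. v x = Some s \<and> v y = Some t \<and> ancestors T s \<approx> ancestors T t)"
| "m_sat (MMem x X) T v V \<longleftrightarrow> (\<exists>s A. v x = Some s \<and> V X = Some A \<and> s \<in> A)"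
| "m_sat (MNot \<phi>) T v V \<longleftrightarrow> \<not> m_sat \<phi> T v V"
| "m_sat (MOr \<phi> \<psi>) T v V \<longleftrightarrow> m_sat \<phi> T v V \<or> m_sat \<psi> T v V"
| "m_sat (MExNode x \<phi>) T v V \<longleftrightarrow> (\<exists>s \<in> nodes T. m_sat \<phi> T (v(x \<mapsto> s)) V)"
| "m_sat (MExPath X \<phi>) T v V \<longleftrightarrow> (\<exists>p \<in> Paths T. m_sat \<phi> T v (V(X \<mapsto> range p)))"

definition m_models :: "('s, 'p) ltree \<Rightarrow> 'p mpl \<Rightarrow> bool" where
  "m_models T \<phi> \<longleftrightarrow> m_sat \<phi> T Map.empty Map.empty"

end

theory Submission
  imports Defs
begin

text \<open>Translation: evaluate everything at position 0, where path quantification is unrestricted.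
  A node is encoded by a path through it together with a quantified proposition true at exactly
  one position of the path, and equality of nodes at a common level is indiscernibility under
  all labelings of a quantified proposition.

  Strictness: compare trees in which \<open>n\<close> or infinitely many branches leave the root and never
  split again. A path or a node picks out at most one branch, so by an Ehrenfeucht-Fraisse
  argument a fixed MPL[E] sentence cannot tell large \<open>n\<close> from infinity. HyperQCTL* can: with
  infinitely many branches a proposition can mark a different level on each branch so that no
  mark is the last one.\<close>

section \<open>Paths of a tree\<close>

lemma ancestor_trans:
  assumes "is_tree T" "ancestor T x y" "ancestor T y z"
  shows "ancestor T x z"
  using assms unfolding is_tree_def partial_order_on_def preorder_on_def ancestor_def
  by (metis antisymD transD)

lemma Paths_node: "p \<in> Paths T \<Longrightarrow> p i \<in> nodes T"
  by (simp add: Paths_def is_path_def)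

lemma Paths_start_eq:
  assumes "is_tree T" "p \<in> Paths T" "p' \<in> Paths T"
  shows "p 0 = p' 0"
  using assms unfolding is_tree_def partial_order_on_def Paths_def is_root_def
  by (auto dest: antisymD)

text \<open>Ancestors of \<open>p (Suc i)\<close> are comparable with \<open>p i\<close>, and one
  above \<open>p i\<close> would lie strictly between two nodes in direct-ancestor relation.\<close>

lemma ancestors_Suc_Paths:
  assumes T: "is_tree T" and p: "p \<in> Paths T"
  shows "ancestors T (p (Suc i)) = insert (p i) (ancestors T (p i))"
proof -
  have d: "direct_ancestor T (p i) (p (Suc i))" and n: "p i \<in> nodes T" "p (Suc i) \<in> nodes T"
    using p by (auto simp: Paths_def is_path_def)
  have a: "ancestor T (p i) (p (Suc i))" using d by (simp add: direct_ancestor_def)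
  have "x = p i \<or> ancestor T x (p i)" if x: "x \<in> nodes T" "ancestor T x (p (Suc i))" for x
  proof (rule ccontr)
    assume c: "\<not> ?thesis"
    have "total_on (ancestors T (p (Suc i))) (le_rel T)" using T n by (simp add: is_tree_def)
    then have "ancestor T (p i) x"
      using x a n c unfolding ancestors_def total_on_def ancestor_def by blast
    then show False using d x by (auto simp: direct_ancestor_def)
  qed
  then show ?thesis using a n ancestor_trans[OF T] by (auto simp: ancestors_def)
qed

text \<open>This ties levels to positions: the node at position \<open>i\<close> of a path from the
  root has exactly the \<open>i\<close> earlier nodes above it.\<close>

lemma ancestors_Paths:
  assumes T: "is_tree T" and p: "p \<in> Paths T"
  shows "ancestors T (p i) = p ` {..<i}"
proof (induction i)
  case 0
  have "\<not> ancestor T x (p 0)" if "x \<in> nodes T" for x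
    using that p T unfolding Paths_def is_root_def ancestor_def is_tree_def partial_order_on_def
    by (auto dest: antisymD)
  then show ?case by (auto simp: ancestors_def)
next
  case (Suc i)
  then show ?case using ancestors_Suc_Paths[OF T p] by (simp add: lessThan_Suc)
qed

lemma inj_Paths:
  assumes T: "is_tree T" and p: "p \<in> Paths T"
  shows "inj p"
proof (rule linorder_injI)
  fix i j :: nat
  assume "i < j"
  then have "p i \<in> ancestors T (p j)" using ancestors_Paths[OF T p] by simp
  then show "p i \<noteq> p j" by (auto simp: ancestors_def ancestor_def)
qed

text \<open>The ancestor sets are injective images of initial segments of the naturals, so they are
  finite of sizes \<open>i\<close> and \<open>j\<close>.\<close>

lemma same_level_Paths_iff:
  assumes T: "is_tree T" and p: "p \<in> Paths T" "p' \<in> Paths T"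
  shows "ancestors T (p i) \<approx> ancestors T (p' j) \<longleftrightarrow> i = j"
  using ancestors_Paths[OF T p(1)] ancestors_Paths[OF T p(2)]
    inj_Paths[OF T p(1)] inj_Paths[OF T p(2)]
  by (simp add: eqpoll_iff_card card_image inj_on_subset)

lemma Paths_same_nodeD:
  assumes "is_tree T" "p \<in> Paths T" "p' \<in> Paths T" "p i = p' j"
  shows "i = j"
  using same_level_Paths_iff[OF assms(1-3)] assms(4) by (metis eqpoll_refl)

text \<open>Branches never merge: \<open>p k\<close> is an ancestor of the common node, hence lies
  on \<open>p'\<close>, and its level forces position \<open>k\<close>.\<close>

lemma Paths_prefix:
  assumes T: "is_tree T" and p: "p \<in> Paths T" "p' \<in> Paths T" and eq: "p i = p' i" and "k \<le> i"
  shows "p k = p' k"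
proof (cases "k = i")
  case False
  then have "p k \<in> p' ` {..<i}"
    using assms ancestors_Paths[OF T p(1), of i] ancestors_Paths[OF T p(2), of i] by auto
  then show ?thesis using Paths_same_nodeD[OF T p] by auto
qed (use eq in simp)

lemma ancestor_Paths_iff:
  assumes T: "is_tree T" and p: "p \<in> Paths T" "p' \<in> Paths T"
  shows "ancestor T (p i) (p' j) \<longleftrightarrow> i < j \<and> p i = p' i"
proof -
  have "ancestor T (p i) (p' j) \<longleftrightarrow> p i \<in> p' ` {..<j}"
    using ancestors_Paths[OF T p(2), of j] Paths_node[OF p(1), of i] by (auto simp: ancestors_def)
  then show ?thesis using Paths_same_nodeD[OF T p] by auto
qed

text \<open>Applied to trees that differ only in \<open>props\<close> and \<open>label\<close>, as
  produced by propositional quantification.\<close>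

lemma Paths_cong:
  assumes "nodes T' = nodes T" "le_rel T' = le_rel T"
  shows "Paths T' = Paths T"
  using assms
  by (simp add: Paths_def is_path_def is_root_def direct_ancestor_def ancestor_def)


section \<open>Translating MPL[E] into HyperQCTL*\<close>

definition HAnd :: "'p hyperqctl \<Rightarrow> 'p hyperqctl \<Rightarrow> 'p hyperqctl" where
  "HAnd \<phi> \<psi> = HNot (HOr (HNot \<phi>) (HNot \<psi>))"

definition HFin :: "'p hyperqctl \<Rightarrow> 'p hyperqctl" where
  "HFin \<phi> = HUntil (HOr \<phi> (HNot \<phi>)) \<phi>"

text \<open>Uniqueness is stated temporally: \<open>HNext\<close> makes the forbidden second
  occurrence strictly later than the first.\<close>

definition HOnce :: "'p hyperqctl \<Rightarrow> 'p hyperqctl" where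
  "HOnce \<phi> = HAnd (HFin \<phi>) (HNot (HFin (HAnd \<phi> (HNext (HFin \<phi>)))))"

text \<open>Leibniz equality. One implication suffices, because \<open>r\<close> may be chosen to
  hold at the node of \<open>x\<close> alone.\<close>

definition HSame :: "'p \<Rightarrow> nat \<Rightarrow> nat \<Rightarrow> 'p hyperqctl" where
  "HSame r x y = HNot (HExProp r (HAnd (HAtom r x) (HNot (HAtom r y))))"

lemma h_sat_HAnd [simp]: "h_sat (HAnd \<phi> \<psi>) T P e i \<longleftrightarrow> h_sat \<phi> T P e i \<and> h_sat \<psi> T P e i"
  by (simp add: HAnd_def)

lemma h_sat_HFin [simp]: "h_sat (HFin \<phi>) T P e i \<longleftrightarrow> (\<exists>k\<ge>i. h_sat \<phi> T P e k)"
  by (auto simp: HFin_def)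

lemma h_sat_HOnce [simp]: "h_sat (HOnce \<phi>) T P e i \<longleftrightarrow> (\<exists>!k. k \<ge> i \<and> h_sat \<phi> T P e k)"
proof -
  have "(\<exists>!k. k \<ge> i \<and> Q k) \<longleftrightarrow> (\<exists>k\<ge>i. Q k) \<and> \<not> (\<exists>k\<ge>i. Q k \<and> (\<exists>l\<ge>Suc k. Q l))"
    for Q :: "nat \<Rightarrow> bool"
  proof
    assume "\<exists>!k. k \<ge> i \<and> Q k"
    then obtain k where k: "k \<ge> i" "Q k" "\<And>l. l \<ge> i \<Longrightarrow> Q l \<Longrightarrow> l = k" by blast
    have False if "m \<ge> i" "Q m" "l \<ge> Suc m" "Q l" for m l
      using k(3)[of m] k(3)[of l] that by simp
    with k show "(\<exists>k\<ge>i. Q k) \<and> \<not> (\<exists>k\<ge>i. Q k \<and> (\<exists>l\<ge>Suc k. Q l))" by blast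
  next
    assume "(\<exists>k\<ge>i. Q k) \<and> \<not> (\<exists>k\<ge>i. Q k \<and> (\<exists>l\<ge>Suc k. Q l))"
    then obtain k where k: "k \<ge> i" "Q k"
      and le: "\<And>k l. k \<ge> i \<Longrightarrow> Q k \<Longrightarrow> Q l \<Longrightarrow> l \<le> k"
      by (auto simp: not_less_eq_eq[symmetric])
    have "l = k" if "l \<ge> i" "Q l" for l
      using le[OF k that(2)] le[OF that k(2)] by simp
    with k show "\<exists>!k. k \<ge> i \<and> Q k" by blast
  qed
  then show ?thesis by (simp add: HOnce_def)
qed

text \<open>Two nodes are equal iff no labeling tells them apart.\<close>

lemma h_sat_HSame:
  assumes "P x = Some p" "p i \<in> nodes T"
  shows "h_sat (HSame r x y) T P e i \<longleftrightarrow> (\<exists>p'. P y = Some p' \<and> p i = p' i)"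
proof
  assume sat: "h_sat (HSame r x y) T P e i"
  \<comment> \<open>The distinguishing labeling: \<open>r\<close> marks \<open>p i\<close> and
    nothing else.\<close>
  let ?L = "\<lambda>s. (label T s \<inter> (props T - {r})) \<union> (if s = p i then {r} else {})"
  show "\<exists>p'. P y = Some p' \<and> p i = p' i"
  proof (rule ccontr)
    assume "\<not> ?thesis"
    then have "\<not> h_sat (HSame r x y) T P e i"
      using assms by (auto simp: HSame_def split: if_splits intro!: exI[of _ ?L])
    with sat show False by simp
  qed
next
  assume "\<exists>p'. P y = Some p' \<and> p i = p' i"
  then obtain p' where "P y = Some p'" "p i = p' i" by blast
  then show "h_sat (HSame r x y) T P e i" using assms(1) by (simp add: HSame_def)
qed

lemma h_syntax_simps [simp]:
  "h_path_vars (HAnd \<phi> \<psi>) = h_path_vars \<phi> \<union> h_path_vars \<psi>"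
  "h_path_vars (HFin \<phi>) = h_path_vars \<phi>"
  "h_path_vars (HOnce \<phi>) = h_path_vars \<phi>"
  "h_path_vars (HSame r x y) = {x, y}"
  "h_props (HAnd \<phi> \<psi>) = h_props \<phi> \<union> h_props \<psi>"
  "h_props (HFin \<phi>) = h_props \<phi>"
  "h_props (HOnce \<phi>) = h_props \<phi>"
  "h_props (HSame r x y) = {}"
  by (auto simp: HAnd_def HFin_def HOnce_def HSame_def)

text \<open>A node variable \<open>x\<close> becomes the path variable \<open>2 * x\<close> together with the proposition
  \<open>q (Suc x)\<close>, which holds at exactly one position of that path; a path variable \<open>X\<close> becomes
  \<open>2 * X + 1\<close>; \<open>q 0\<close> serves for node equality. All path quantifiers stay at position 0, where
  any path from the root is allowed.\<close>

primrec translate :: "(nat \<Rightarrow> 'p) \<Rightarrow> 'p mpl \<Rightarrow> 'p hyperqctl" where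
  "translate q (MPred a x) = HFin (HAnd (HAtom (q (Suc x)) (2 * x)) (HAtom a (2 * x)))"
| "translate q (MLess x y) =
     HFin (HAnd (HAtom (q (Suc x)) (2 * x))
       (HAnd (HNext (HFin (HAtom (q (Suc y)) (2 * y)))) (HSame (q 0) (2 * x) (2 * y))))"
| "translate q (MEq x y) =
     HFin (HAnd (HAtom (q (Suc x)) (2 * x))
       (HAnd (HAtom (q (Suc y)) (2 * y)) (HSame (q 0) (2 * x) (2 * y))))"
| "translate q (MLevel x y) =
     HFin (HAnd (HAtom (q (Suc x)) (2 * x)) (HAtom (q (Suc y)) (2 * y)))"
| "translate q (MMem x X) =
     HFin (HAnd (HAtom (q (Suc x)) (2 * x))
       (HSame (q 0) (2 * x) (2 * X + 1)))"
| "translate q (MNot \<phi>) = HNot (translate q \<phi>)"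
| "translate q (MOr \<phi> \<psi>) = HOr (translate q \<phi>) (translate q \<psi>)"
| "translate q (MExNode x \<phi>) =
     HExPath (2 * x) (HExProp (q (Suc x))
       (HAnd (HOnce (HAtom (q (Suc x)) (2 * x))) (translate q \<phi>)))"
| "translate q (MExPath X \<phi>) = HExPath (2 * X + 1) (translate q \<phi>)"

section \<open>Correctness of the translation: free symbols, then truth\<close>

lemma h_path_vars_translate:
  "h_path_vars (translate q \<phi>)
     \<subseteq> (\<lambda>x. 2 * x) ` m_fo_vars \<phi> \<union> (\<lambda>X. 2 * X + 1) ` m_so_vars \<phi>"
  by (induction \<phi>) auto

text \<open>\<open>q 0\<close> occurs only under \<open>HSame\<close>, which binds it, and
  \<open>MExNode\<close> binds \<open>q (Suc x)\<close>; a translated sentence keeps only its own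
  propositions free.\<close>

lemma h_props_translate:
  "h_props (translate q \<phi>) \<subseteq> m_props \<phi> \<union> (\<lambda>x. q (Suc x)) ` m_fo_vars \<phi>"
  by (induction \<phi>) auto

text \<open>Requiring \<open>m \<in> props T'\<close> protects the mark: later relabelings for other
  propositions must agree with the current labels on \<open>props T'\<close>.\<close>

definition node_code ::
    "('s, 'p) ltree \<Rightarrow> ('s, 'p) ltree \<Rightarrow> 'p \<Rightarrow> (nat \<Rightarrow> 's) \<Rightarrow> 's \<Rightarrow> bool" where
  "node_code T T' m p s \<longleftrightarrow> p \<in> Paths T \<and> m \<in> props T' \<and>
     (\<exists>i. s = p i \<and> (\<forall>j. m \<in> label T' (p j) \<longleftrightarrow> j = i))"

text \<open>The invariant of the translation: \<open>T\<close> is the original tree,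
  \<open>T'\<close> its current relabeling, and \<open>M\<close> the propositions whose meaning must
  not change. Through \<open>rel_option\<close>, unassigned variables correspond to unassigned
  ones.\<close>

definition codes ::
    "(nat \<Rightarrow> 'p) \<Rightarrow> 'p set \<Rightarrow> ('s, 'p) ltree \<Rightarrow> ('s, 'p) ltree \<Rightarrow>
     (nat \<rightharpoonup> 's) \<Rightarrow> (nat \<rightharpoonup> 's set) \<Rightarrow> (nat \<rightharpoonup> (nat \<Rightarrow> 's)) \<Rightarrow> bool" where
  "codes q M T T' v V P \<longleftrightarrow>
     nodes T' = nodes T \<and> le_rel T' = le_rel T \<and> M \<subseteq> props T' \<and>
     (\<forall>s\<in>nodes T. \<forall>a\<in>M. a \<in> label T' s \<longleftrightarrow> a \<in> label T s) \<and>
     (\<forall>x. rel_option (node_code T T' (q (Suc x))) (P (2 * x)) (v x)) \<and>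
     (\<forall>X. rel_option (\<lambda>p A. p \<in> Paths T \<and> A = range p) (P (2 * X + 1)) (V X))"

lemma codes_node:
  assumes "codes q M T T' v V P"
  obtains "v x = None" "P (2 * x) = None"
  | p i where "v x = Some (p i)" "P (2 * x) = Some p" "p \<in> Paths T"
      "\<And>j. q (Suc x) \<in> label T' (p j) \<longleftrightarrow> j = i"
proof -
  have "rel_option (node_code T T' (q (Suc x))) (P (2 * x)) (v x)"
    using assms by (simp add: codes_def)
  then show thesis
    using that by (cases rule: option.rel_cases) (auto simp: node_code_def)
qed

lemma codes_path:
  assumes "codes q M T T' v V P"
  obtains "V X = None" "P (2 * X + 1) = None"
  | p where "V X = Some (range p)" "P (2 * X + 1) = Some p" "p \<in> Paths T"
proof -
  have "rel_option (\<lambda>p A. p \<in> Paths T \<and> A = range p) (P (2 * X + 1)) (V X)"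
    using assms by (simp add: codes_def)
  then show thesis
    using that by (cases rule: option.rel_cases) auto
qed

lemma codes_ExPath:
  assumes "codes q M T T' v V P" "p \<in> Paths T"
  shows "codes q M T T' v (V(X \<mapsto> range p)) (P(2 * X + 1 \<mapsto> p))"
proof -
  \<comment> \<open>By parity, updating a path variable leaves all codes of node variables
    intact.\<close>
  have "2 * x \<noteq> Suc (2 * X)" for x by presburger
  then show ?thesis using assms by (auto simp: codes_def)
qed

text \<open>The new labeling may alter only the mark \<open>q (Suc x)\<close>. By injectivity of
  \<open>q\<close> the marks of other variables survive, and \<open>q (Suc x) \<notin> M\<close>
  keeps the propositions in \<open>M\<close> unchanged.\<close>

lemma codes_ExNode:
  assumes c: "codes q M T T' v V P" and q: "inj q" "q (Suc x) \<notin> M"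
    and L: "\<And>s. s \<in> nodes T \<Longrightarrow>
      L s \<inter> (props T' - {q (Suc x)}) = label T' s \<inter> (props T' - {q (Suc x)})"
    and p: "p \<in> Paths T" "\<And>j. q (Suc x) \<in> L (p j) \<longleftrightarrow> j = i"
  shows "codes q M T (T'\<lparr>props := props T' \<union> {q (Suc x)}, label := L\<rparr>)
    (v(x \<mapsto> p i)) V (P(2 * x \<mapsto> p))"
proof -
  let ?T = "T'\<lparr>props := props T' \<union> {q (Suc x)}, label := L\<rparr>"
  have L': "a \<in> L s \<longleftrightarrow> a \<in> label T' s"
    if "s \<in> nodes T" "a \<in> props T'" "a \<noteq> q (Suc x)" for a s
    using L that by blast
  have "node_code T ?T (q (Suc y)) p' s" if "node_code T T' (q (Suc y)) p' s" "y \<noteq> x" for y p' s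
    using that L' Paths_node[of p' T] inj_eq[OF q(1)] by (simp add: node_code_def)
  then have "rel_option (node_code T ?T (q (Suc y))) (P (2 * y)) (v y)" if "y \<noteq> x" for y
    using that c by (auto simp: codes_def intro: option.rel_mono_strong)
  moreover have "node_code T ?T (q (Suc x)) p (p i)"
    using p by (auto simp: node_code_def)
  moreover have "Suc (2 * X) \<noteq> 2 * x" for X by presburger
  moreover have "a \<in> L s \<longleftrightarrow> a \<in> label T s" if "s \<in> nodes T" "a \<in> M" for a s
    using that L'[of s a] q(2) c by (auto simp: codes_def)
  ultimately show ?thesis
    using c by (auto simp: codes_def)
qed

text \<open>Induction with \<open>T'\<close> varying, since each node quantifier relabels the tree.
  Evaluation stays at position 0 and \<open>e\<close> is at most a path from the root, so the prefix
  condition of \<open>HExPath\<close> never restricts the choice.\<close>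

lemma h_sat_translate:
  assumes T: "is_tree T" "all_nodes_on_paths T" and q: "inj q" "range q \<inter> M = {}"
  shows "codes q M T T' v V P \<Longrightarrow> m_props \<phi> \<subseteq> M \<Longrightarrow> set_option e \<subseteq> Paths T \<Longrightarrow>
    h_sat (translate q \<phi>) T' P e 0 \<longleftrightarrow> m_sat \<phi> T v V"
proof (induction \<phi> arbitrary: T' v V P e)
  case (MPred a x)
  from MPred.prems(1) show ?case
    apply (cases rule: codes_node[of _ _ _ _ _ _ _ x])
    using MPred.prems by (auto simp: codes_def Paths_node)
next
  case (MLess x y)
  have n: "nodes T' = nodes T" using MLess.prems(1) by (simp add: codes_def)
  from MLess.prems(1) show ?case
  proof (cases rule: codes_node[of _ _ _ _ _ _ _ x])
    case (2 p i)
    from MLess.prems(1) show ?thesis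
    proof (cases rule: codes_node[of _ _ _ _ _ _ _ y])
      case y: (2 p' j)
      show ?thesis
        using 2 y n ancestor_Paths_iff[OF T(1) 2(3) y(3), of i j]
        by (auto simp: Paths_node h_sat_HSame)
    qed simp
  qed simp
next
  case (MEq x y)
  have n: "nodes T' = nodes T" using MEq.prems(1) by (simp add: codes_def)
  from MEq.prems(1) show ?case
  proof (cases rule: codes_node[of _ _ _ _ _ _ _ x])
    case (2 p i)
    from MEq.prems(1) show ?thesis
    proof (cases rule: codes_node[of _ _ _ _ _ _ _ y])
      case y: (2 p' j)
      show ?thesis
        using 2 y n Paths_same_nodeD[OF T(1) 2(3) y(3), of i j]
        by (auto simp: Paths_node h_sat_HSame)
    qed simp
  qed simp
next
  case (MLevel x y)
  from MLevel.prems(1) show ?case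
  proof (cases rule: codes_node[of _ _ _ _ _ _ _ x])
    case (2 p i)
    from MLevel.prems(1) show ?thesis
    proof (cases rule: codes_node[of _ _ _ _ _ _ _ y])
      case y: (2 p' j)
      show ?thesis
        using 2 y same_level_Paths_iff[OF T(1) 2(3) y(3), of i j] by auto
    qed simp
  qed simp
next
  case (MMem x X)
  have n: "nodes T' = nodes T" using MMem.prems(1) by (simp add: codes_def)
  from MMem.prems(1) show ?case
  proof (cases rule: codes_node[of _ _ _ _ _ _ _ x])
    case (2 p i)
    from MMem.prems(1) show ?thesis
    proof (cases rule: codes_path[of _ _ _ _ _ _ _ X])
      case 1
      then show ?thesis using 2 n by (auto simp: Paths_node h_sat_HSame)
    next
      case y: (2 p')
      show ?thesis
        using 2 y n Paths_same_nodeD[OF T(1) 2(3) y(3), of i]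
        by (auto simp: Paths_node h_sat_HSame)
    qed
  qed simp
next
  case (MNot \<phi>)
  then show ?case by simp
next
  case (MOr \<phi> \<psi>)
  then show ?case by simp
next
  case (MExNode x \<phi>)
  let ?m = "q (Suc x)"
  have m: "?m \<notin> M" using q(2) by auto
  have n: "nodes T' = nodes T" and P: "Paths T' = Paths T"
    using MExNode.prems(1) by (auto simp: codes_def intro!: Paths_cong)
  have props: "m_props \<phi> \<subseteq> M" using MExNode.prems(2) by simp
  have unfold: "h_sat (translate q (MExNode x \<phi>)) T' P e 0 \<longleftrightarrow>
      (\<exists>p\<in>Paths T. \<exists>L. (\<forall>s\<in>nodes T. L s \<subseteq> props T' \<union> {?m} \<and>
          L s \<inter> (props T' - {?m}) = label T' s \<inter> (props T' - {?m})) \<and>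
        (\<exists>!i. ?m \<in> L (p i)) \<and>
        h_sat (translate q \<phi>) (T'\<lparr>props := props T' \<union> {?m}, label := L\<rparr>)
          (P(2 * x \<mapsto> p)) (Some p) 0)"
  proof -
    \<comment> \<open>At position 0 the prefix condition compares only the roots.\<close>
    have "p 0 = p' 0" if "p \<in> Paths T" "e = Some p'" for p p'
      using that MExNode.prems(3) Paths_start_eq[OF T(1)] by simp
    then show ?thesis by (simp add: n P cong: bex_cong)
  qed
  have IH: "h_sat (translate q \<phi>) (T'\<lparr>props := props T' \<union> {?m}, label := L\<rparr>)
      (P(2 * x \<mapsto> p)) (Some p) 0 \<longleftrightarrow> m_sat \<phi> T (v(x \<mapsto> p i)) V"
    if "\<And>s. s \<in> nodes T \<Longrightarrow> L s \<inter> (props T' - {?m}) = label T' s \<inter> (props T' - {?m})"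
      and "p \<in> Paths T" and "\<And>j. ?m \<in> L (p j) \<longleftrightarrow> j = i" for p i L
    using that by (intro MExNode.IH codes_ExNode MExNode.prems(1) q(1) m props) auto
  show ?case
  proof
    assume "h_sat (translate q (MExNode x \<phi>)) T' P e 0"
    then obtain p L where p: "p \<in> Paths T"
      and L: "\<forall>s\<in>nodes T. L s \<subseteq> props T' \<union> {?m} \<and>
          L s \<inter> (props T' - {?m}) = label T' s \<inter> (props T' - {?m})"
      and ex1: "\<exists>!i. ?m \<in> L (p i)"
      and sat: "h_sat (translate q \<phi>) (T'\<lparr>props := props T' \<union> {?m}, label := L\<rparr>)
                  (P(2 * x \<mapsto> p)) (Some p) 0"
      unfolding unfold by (elim bexE exE conjE)
    from ex1 obtain i where i: "\<And>j. ?m \<in> L (p j) \<longleftrightarrow> j = i" by blast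
    have L: "L s \<inter> (props T' - {?m}) = label T' s \<inter> (props T' - {?m})" if "s \<in> nodes T" for s
      using L that by simp
    from sat have "m_sat \<phi> T (v(x \<mapsto> p i)) V"
      using IH[of L p i, OF L p i] by simp
    then show "m_sat (MExNode x \<phi>) T v V" using Paths_node[OF p] by auto
  next
    assume "m_sat (MExNode x \<phi>) T v V"
    then obtain s where "s \<in> nodes T" and sat: "m_sat \<phi> T (v(x \<mapsto> s)) V" by auto
    \<comment> \<open>A node can be coded because it lies on some path from the root; this is the
      use of \<open>all_nodes_on_paths\<close>.\<close>
    then obtain p i where p: "p \<in> Paths T" and s: "s = p i"
      using T(2) by (auto simp: all_nodes_on_paths_def)
    \<comment> \<open>An old mark of the same variable is erased first, so that rebinding
      \<open>x\<close> still leaves exactly one marked position.\<close>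
    define L where "L t = (label T' t \<inter> (props T' - {?m})) \<union> (if t = s then {?m} else {})" for t
    have L: "L t \<inter> (props T' - {?m}) = label T' t \<inter> (props T' - {?m})"
        "L t \<subseteq> props T' \<union> {?m}" for t
      by (auto simp: L_def)
    have i: "?m \<in> L (p j) \<longleftrightarrow> j = i" for j
      using inj_eq[OF inj_Paths[OF T(1) p]] s by (simp add: L_def)
    have "h_sat (translate q \<phi>) (T'\<lparr>props := props T' \<union> {?m}, label := L\<rparr>)
            (P(2 * x \<mapsto> p)) (Some p) 0"
      using IH[of L p i, OF L(1) p i] sat s by simp
    then show "h_sat (translate q (MExNode x \<phi>)) T' P e 0"
      unfolding unfold using p L i by (intro bexI[of _ p] exI[of _ L]) auto
  qed
next
  case (MExPath X \<phi>)
  have P: "Paths T' = Paths T"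
    using MExPath.prems(1) by (auto simp: codes_def intro!: Paths_cong)
  have "h_sat (translate q \<phi>) T' (P(2 * X + 1 \<mapsto> p)) (Some p) 0
      \<longleftrightarrow> m_sat \<phi> T v (V(X \<mapsto> range p))" if "p \<in> Paths T" for p
    using that MExPath.prems(2) by (intro MExPath.IH codes_ExPath MExPath.prems(1)) auto
  moreover have "p 0 = p' 0" if "p \<in> Paths T" "e = Some p'" for p p'
    using that MExPath.prems(3) Paths_start_eq[OF T(1)] by simp
  ultimately show ?case using P by auto
qed

section \<open>Every MPL[E] sentence has an equivalent formula\<close>

lemma finite_m_props: "finite (m_props \<phi>)"
  by (induction \<phi>) auto

lemma mpl_to_hyperqctl:
  fixes \<phi> :: "'p mpl"
  assumes "infinite (UNIV :: 'p set)" and \<phi>: "m_sentence AP \<phi>"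
  shows "\<exists>\<psi>. h_closed AP \<psi> \<and>
    (\<forall>T :: ('s, 'p) ltree. labeled_tree AP T \<and> all_nodes_on_paths T \<longrightarrow>
       (m_models T \<phi> \<longleftrightarrow> h_models T \<psi>))"
proof -
  \<comment> \<open>Fresh names need only avoid the finitely many propositions of
    \<open>\<phi>\<close>. They may lie in \<open>AP\<close>, which can exhaust the type; the
    quantifiers then shadow them.\<close>
  have "infinite (- m_props \<phi>)"
    using assms(1) finite_m_props[of \<phi>] by (simp add: Compl_eq_Diff_UNIV)
  then obtain q :: "nat \<Rightarrow> 'p" where q: "inj q" "range q \<inter> m_props \<phi> = {}"
    by (metis infinite_countable_subset disjoint_eq_subset_Compl)
  have "h_closed AP (translate q \<phi>)"
    using \<phi> h_path_vars_translate[of q \<phi>] h_props_translate[of q \<phi>]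
    by (auto simp: h_closed_def m_sentence_def)
  moreover have "m_models T \<phi> \<longleftrightarrow> h_models T (translate q \<phi>)"
    if T: "labeled_tree AP T" "all_nodes_on_paths T" for T :: "('s, 'p) ltree"
  proof -
    have "codes q (m_props \<phi>) T T Map.empty Map.empty Map.empty"
      using T \<phi> by (auto simp: codes_def labeled_tree_def m_sentence_def)
    then show ?thesis
      using T h_sat_translate[OF _ T(2) q] by (simp add: m_models_def h_models_def labeled_tree_def)
  qed
  ultimately show ?thesis by blast
qed


section \<open>Star-shaped trees\<close>

text \<open>\<open>br b i\<close> is the node at level \<open>i\<close> of branch \<open>b\<close>;
  the branches share level 0, the root, and are disjoint above it.\<close>

locale star_branches =
  fixes br :: "nat \<Rightarrow> nat \<Rightarrow> 's"
  assumes br_eq_iff: "br b i = br c j \<longleftrightarrow> i = j \<and> (i = 0 \<or> b = c)"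
begin

text \<open>All labels are empty, so two stars can differ only in their sets of branches.\<close>

definition star :: "'p set \<Rightarrow> nat set \<Rightarrow> ('s, 'p) ltree" where
  "star AP N = \<lparr>nodes = {br b i | b i. b \<in> N}, le_rel = {(br b i, br b j) | b i j. b \<in> N \<and> i \<le> j},
     props = AP, label = \<lambda>_. {}\<rparr>"

lemma star_simps [simp]:
  "nodes (star AP N) = {br b i | b i. b \<in> N}" "props (star AP N) = AP" "label (star AP N) s = {}"
  by (simp_all add: star_def)

lemma le_rel_star:
  assumes "b \<in> N" "c \<in> N"
  shows "(br b i, br c j) \<in> le_rel (star AP N) \<longleftrightarrow> i \<le> j \<and> (i = 0 \<or> b = c)"
  using assms by (fastforce simp: star_def br_eq_iff)

lemma ancestor_star:
  assumes "b \<in> N" "c \<in> N"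
  shows "ancestor (star AP N) (br b i) (br c j) \<longleftrightarrow> i < j \<and> (i = 0 \<or> b = c)"
  using le_rel_star[OF assms] by (auto simp: ancestor_def br_eq_iff)

lemma partial_order_star: "partial_order_on (nodes (star AP N)) (le_rel (star AP N))"
proof -
  have sub: "le_rel (star AP N) \<subseteq> nodes (star AP N) \<times> nodes (star AP N)"
    by (auto simp: star_def)
  have "refl_on (nodes (star AP N)) (le_rel (star AP N))"
    by (auto simp: refl_on_def le_rel_star)
  moreover have "trans (le_rel (star AP N))"
  proof (rule transI)
    fix x y z
    assume xy: "(x, y) \<in> le_rel (star AP N)" and yz: "(y, z) \<in> le_rel (star AP N)"
    then obtain b i c j d k where "x = br b i" "y = br c j" "z = br d k" "b \<in> N" "c \<in> N" "d \<in> N"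
      using subsetD[OF sub xy] subsetD[OF sub yz] by auto
    with xy yz show "(x, z) \<in> le_rel (star AP N)" by (auto simp: le_rel_star)
  qed
  moreover have "antisym (le_rel (star AP N))"
  proof (rule antisymI)
    fix x y
    assume xy: "(x, y) \<in> le_rel (star AP N)" "(y, x) \<in> le_rel (star AP N)"
    then obtain b i c j where "x = br b i" "y = br c j" "b \<in> N" "c \<in> N"
      using subsetD[OF sub xy(1)] by auto
    with xy show "x = y" by (auto simp: le_rel_star br_eq_iff)
  qed
  ultimately show ?thesis using sub by (simp add: partial_order_on_def preorder_on_def)
qed

lemma is_root_star:
  assumes "b \<in> N"
  shows "is_root (star AP N) (br b 0)"
  using assms by (auto simp: is_root_def le_rel_star)

lemma is_tree_star:
  assumes "N \<noteq> {}"
  shows "is_tree (star AP N)"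
proof -
  from assms obtain b where b: "b \<in> N" by auto
  have "inj (br b)" by (auto simp: inj_def br_eq_iff)
  then have "infinite (range (br b))" by (rule range_inj_infinite)
  moreover have "range (br b) \<subseteq> nodes (star AP N)" using b by auto
  ultimately have "infinite (nodes (star AP N))" by (rule infinite_super[rotated])
  moreover have "total_on (ancestors (star AP N) s) (le_rel (star AP N))"
    if "s \<in> nodes (star AP N)" for s
    using that by (force simp: total_on_def ancestors_def ancestor_star le_rel_star)
  ultimately show ?thesis
    using is_root_star[OF b] partial_order_star unfolding is_tree_def by blast
qed

lemma br_in_Paths:
  assumes "b \<in> N"
  shows "br b \<in> Paths (star AP N)"
proof -
  have "direct_ancestor (star AP N) (br b i) (br b (Suc i))" for i
    using assms by (auto simp: direct_ancestor_def ancestor_star)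
  then show ?thesis using assms is_root_star by (auto simp: Paths_def is_path_def)
qed

text \<open>A path is determined by its node at level 1, since branches do not meet again beyond the
  root.\<close>

lemma Paths_star:
  assumes "N \<noteq> {}"
  shows "Paths (star AP N) = br ` N"
proof
  show "Paths (star AP N) \<subseteq> br ` N"
  proof
    fix p
    assume p: "p \<in> Paths (star AP N)"
    note T = is_tree_star[OF assms, of AP]
    have *: "\<exists>b\<in>N. p i = br b i" for i
    proof -
      obtain b j where "b \<in> N" "p i = br b j" using Paths_node[OF p, of i] by auto
      then show ?thesis using Paths_same_nodeD[OF T p br_in_Paths] by metis
    qed
    \<comment> \<open>Level 1 is the first level that identifies the branch.\<close>
    then obtain b where b: "b \<in> N" "p 1 = br b 1" by metis
    have "p i = br b i" for i
    proof -
      obtain c where c: "c \<in> N" "p i = br c i" using * by metis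
      show ?thesis
      proof (cases "i = 0")
        case False
        then have "p 1 = br c 1"
          using Paths_prefix[OF T p br_in_Paths[OF c(1)] c(2), of 1] by simp
        then show ?thesis using b c by (simp add: br_eq_iff)
      qed (use c in \<open>simp add: br_eq_iff\<close>)
    qed
    then show "p \<in> br ` N" using b by auto
  qed
next
  show "br ` N \<subseteq> Paths (star AP N)" using br_in_Paths by blast
qed

lemma labeled_tree_star: "N \<noteq> {} \<Longrightarrow> labeled_tree AP (star AP N)"
  by (simp add: labeled_tree_def is_tree_star)

lemma all_nodes_on_paths_star: "N \<noteq> {} \<Longrightarrow> all_nodes_on_paths (star AP N)"
  by (auto simp: all_nodes_on_paths_def Paths_star)

end


section \<open>MPL[E] cannot distinguish large stars\<close>

primrec quantifier_rank :: "'p mpl \<Rightarrow> nat" where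
  "quantifier_rank (MPred a x) = 0"
| "quantifier_rank (MLess x y) = 0"
| "quantifier_rank (MEq x y) = 0"
| "quantifier_rank (MLevel x y) = 0"
| "quantifier_rank (MMem x X) = 0"
| "quantifier_rank (MNot \<phi>) = quantifier_rank \<phi>"
| "quantifier_rank (MOr \<phi> \<psi>) = max (quantifier_rank \<phi>) (quantifier_rank \<psi>)"
| "quantifier_rank (MExNode x \<phi>) = Suc (quantifier_rank \<phi>)"
| "quantifier_rank (MExPath X \<phi>) = Suc (quantifier_rank \<phi>)"

text \<open>A position of the Ehrenfeucht-Fraisse game with \<open>k\<close> rounds to go: a finite partial
  bijection between the branches of the two stars.\<close>

definition game_position :: "nat \<Rightarrow> nat set \<Rightarrow> nat set \<Rightarrow> (nat \<times> nat) set \<Rightarrow> bool" where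
  "game_position k N M R \<longleftrightarrow> R \<subseteq> N \<times> M \<and> finite R \<and>
     (\<forall>(b, c)\<in>R. \<forall>(b', c')\<in>R. b = b' \<longleftrightarrow> c = c') \<and>
     (finite N \<longrightarrow> card R + k \<le> card N) \<and> (finite M \<longrightarrow> card R + k \<le> card M)"

lemma game_position_converse: "game_position k N M R \<Longrightarrow> game_position k M N (R\<inverse>)"
  by (auto simp: game_position_def)

lemma game_position_mono: "game_position k N M R \<Longrightarrow> l \<le> k \<Longrightarrow> game_position l N M R"
  by (auto simp: game_position_def)

text \<open>If \<open>b\<close> is already paired, its partner answers. Otherwise the cardinality
  bound leaves at least one unpaired branch in \<open>M\<close>, and pairing it uses up one
  round.\<close>

lemma game_position_extend:
  assumes g: "game_position (Suc k) N M R" and b: "b \<in> N"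
  obtains c R' where "c \<in> M" "(b, c) \<in> R'" "R \<subseteq> R'" "game_position k N M R'"
proof (cases "b \<in> fst ` R")
  case True
  then obtain c where "(b, c) \<in> R" by force
  moreover have "c \<in> M" using g \<open>(b, c) \<in> R\<close> by (auto simp: game_position_def)
  ultimately show thesis using that game_position_mono[OF g, of k] by auto
next
  case False
  have fin: "finite R" using g by (simp add: game_position_def)
  have "\<not> M \<subseteq> snd ` R"
  proof
    assume sub: "M \<subseteq> snd ` R"
    then have "finite M" using fin by (meson finite_imageI finite_subset)
    moreover have "card M \<le> card R"
      using sub fin by (meson card_image_le card_mono finite_imageI le_trans)
    ultimately show False using g by (simp add: game_position_def)
  qed
  then obtain c where c: "c \<in> M" "c \<notin> snd ` R" by auto
  have "(b, c) \<notin> R" using False by force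
  then have "card (insert (b, c) R) = Suc (card R)" using fin by simp
  moreover have "b' \<noteq> b \<and> c' \<noteq> c" if "(b', c') \<in> R" for b' c'
    using that False c by force
  ultimately have "game_position k N M (insert (b, c) R)"
    using g b c by (auto simp: game_position_def)
  then show thesis using that c by blast
qed

section \<open>Ehrenfeucht-Fraisse transfer between stars\<close>

context star_branches
begin

text \<open>The level \<open>i\<close> is copied unchanged, which preserves
  \<open>E\<close>.\<close>

definition node_match :: "(nat \<times> nat) set \<Rightarrow> 's \<Rightarrow> 's \<Rightarrow> bool" where
  "node_match R s t \<longleftrightarrow> (\<exists>(b, c)\<in>R. \<exists>i. s = br b i \<and> t = br c i)"

definition path_match :: "(nat \<times> nat) set \<Rightarrow> 's set \<Rightarrow> 's set \<Rightarrow> bool" where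
  "path_match R A B \<longleftrightarrow> (\<exists>(b, c)\<in>R. A = range (br b) \<and> B = range (br c))"

definition matching where
  "matching R v v' V V' \<longleftrightarrow> (\<forall>x :: nat. rel_option (node_match R) (v x) (v' x)) \<and>
     (\<forall>X :: nat. rel_option (path_match R) (V X) (V' X))"

lemma matching_mono: "matching R v v' V V' \<Longrightarrow> R \<subseteq> R' \<Longrightarrow> matching R' v v' V V'"
  unfolding matching_def node_match_def path_match_def
  by (fast intro: option.rel_mono_strong)

lemma matching_converse:
  assumes "matching R v v' V V'"
  shows "matching (R\<inverse>) v' v V' V"
proof -
  have "node_match (R\<inverse>) = (node_match R)\<inverse>\<inverse>" "path_match (R\<inverse>) = (path_match R)\<inverse>\<inverse>"
    by (fastforce simp: node_match_def path_match_def fun_eq_iff)+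
  then show ?thesis using assms by (simp add: matching_def option.rel_conversep)
qed

lemma matching_node:
  assumes "matching R v v' V V'"
  obtains "v x = None" "v' x = None"
  | b c i where "(b, c) \<in> R" "v x = Some (br b i)" "v' x = Some (br c i)"
proof -
  have "rel_option (node_match R) (v x) (v' x)" using assms by (simp add: matching_def)
  then show thesis using that by (cases rule: option.rel_cases) (auto simp: node_match_def)
qed

lemma matching_path:
  assumes "matching R v v' V V'"
  obtains "V X = None" "V' X = None"
  | b c where "(b, c) \<in> R" "V X = Some (range (br b))" "V' X = Some (range (br c))"
proof -
  have "rel_option (path_match R) (V X) (V' X)" using assms by (simp add: matching_def)
  then show thesis using that by (cases rule: option.rel_cases) (auto simp: path_match_def)
qed

lemma matching_ExNode:
  "matching R v v' V V' \<Longrightarrow> (b, c) \<in> R \<Longrightarrow> matching R (v(x \<mapsto> br b i)) (v'(x \<mapsto> br c i)) V V'"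
  by (auto simp: matching_def node_match_def)

lemma matching_ExPath:
  "matching R v v' V V' \<Longrightarrow> (b, c) \<in> R \<Longrightarrow>
     matching R v v' (V(X \<mapsto> range (br b))) (V'(X \<mapsto> range (br c)))"
  by (auto simp: matching_def path_match_def)

lemma same_level_star:
  assumes "b \<in> N" "c \<in> N"
  shows "ancestors (star AP N) (br b i) \<approx> ancestors (star AP N) (br c j) \<longleftrightarrow> i = j"
  using assms by (intro same_level_Paths_iff is_tree_star br_in_Paths) auto

text \<open>Atoms depend only on levels and on equality of branches, both preserved by a matching
  along a partial bijection. Each quantifier selects a single branch, answered by
  \<open>game_position_extend\<close>.\<close>

lemma m_sat_star_transfer:
  fixes \<phi> :: "'p mpl"
  assumes "game_position (quantifier_rank \<phi>) N M R" "matching R v v' V V'" "N \<noteq> {}" "M \<noteq> {}"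
  shows "m_sat \<phi> (star AP N) v V \<longleftrightarrow> m_sat \<phi> (star AP M) v' V'"
  using assms
proof (induction \<phi> arbitrary: N M R v v' V V')
  case (MPred a x)
  then show ?case by simp
next
  case (MLess x y)
  have sub: "R \<subseteq> N \<times> M" and bij: "\<And>b c b' c'. (b, c) \<in> R \<Longrightarrow> (b', c') \<in> R \<Longrightarrow> b = b' \<longleftrightarrow> c = c'"
    using MLess.prems(1) by (auto simp: game_position_def)
  from MLess.prems(2) show ?case
  proof (cases rule: matching_node[of _ _ _ _ _ x])
    case x: (2 b c i)
    from MLess.prems(2) show ?thesis
    proof (cases rule: matching_node[of _ _ _ _ _ y])
      case y: (2 b' c' j)
      have "b \<in> N" "b' \<in> N" "c \<in> M" "c' \<in> M" using sub x y by auto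
      then show ?thesis using x y bij[OF x(1) y(1)] by (simp add: ancestor_star)
    qed simp
  qed simp
next
  case (MEq x y)
  have bij: "\<And>b c b' c'. (b, c) \<in> R \<Longrightarrow> (b', c') \<in> R \<Longrightarrow> b = b' \<longleftrightarrow> c = c'"
    using MEq.prems(1) by (auto simp: game_position_def)
  from MEq.prems(2) show ?case
  proof (cases rule: matching_node[of _ _ _ _ _ x])
    case x: (2 b c i)
    from MEq.prems(2) show ?thesis
    proof (cases rule: matching_node[of _ _ _ _ _ y])
      case y: (2 b' c' j)
      then show ?thesis using x bij[OF x(1) y(1)] by (simp add: br_eq_iff)
    qed simp
  qed simp
next
  case (MLevel x y)
  have sub: "R \<subseteq> N \<times> M" using MLevel.prems(1) by (auto simp: game_position_def)
  from MLevel.prems(2) show ?case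
  proof (cases rule: matching_node[of _ _ _ _ _ x])
    case x: (2 b c i)
    from MLevel.prems(2) show ?thesis
    proof (cases rule: matching_node[of _ _ _ _ _ y])
      case y: (2 b' c' j)
      have "b \<in> N" "b' \<in> N" "c \<in> M" "c' \<in> M" using sub x y by auto
      then show ?thesis using x y by (simp add: same_level_star)
    qed simp
  qed simp
next
  case (MMem x X)
  have bij: "\<And>b c b' c'. (b, c) \<in> R \<Longrightarrow> (b', c') \<in> R \<Longrightarrow> b = b' \<longleftrightarrow> c = c'"
    using MMem.prems(1) by (auto simp: game_position_def)
  from MMem.prems(2) show ?case
  proof (cases rule: matching_node[of _ _ _ _ _ x])
    case x: (2 b c i)
    from MMem.prems(2) show ?thesis
    proof (cases rule: matching_path[of _ _ _ _ _ X])
      case y: (2 b' c')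
      \<comment> \<open>A node belongs to a branch iff it is the root or its own branch index is
        that one.\<close>
      then show ?thesis using x bij[OF x(1) y(1)] by (auto simp: br_eq_iff image_iff)
    qed simp
  qed simp
next
  case (MNot \<phi>)
  then show ?case by simp
next
  case (MOr \<phi> \<psi>)
  have "game_position (quantifier_rank \<phi>) N M R" "game_position (quantifier_rank \<psi>) N M R"
    using MOr.prems(1) by (auto intro: game_position_mono)
  then show ?case using MOr.IH MOr.prems by simp
next
  case (MExNode x \<phi>)
  \<comment> \<open>Stated for arbitrary stars, so that the back direction is the same claim for
    \<open>R\<inverse>\<close>.\<close>
  have step: "m_sat (MExNode x \<phi>) (star AP M) v' V'"
    if sat: "m_sat (MExNode x \<phi>) (star AP N) v V" and "N \<noteq> {}" "M \<noteq> {}"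
      and g: "game_position (Suc (quantifier_rank \<phi>)) N M R" and m: "matching R v v' V V'"
    for N M R v v' V V'
  proof -
    obtain b i where b: "b \<in> N" and 1: "m_sat \<phi> (star AP N) (v(x \<mapsto> br b i)) V"
      using sat by auto
    obtain c R' where c: "c \<in> M" "(b, c) \<in> R'" "R \<subseteq> R'"
      and g': "game_position (quantifier_rank \<phi>) N M R'"
      using game_position_extend[OF g b] by metis
    have "matching R' (v(x \<mapsto> br b i)) (v'(x \<mapsto> br c i)) V V'"
      using m c by (auto intro: matching_ExNode matching_mono)
    then have "m_sat \<phi> (star AP M) (v'(x \<mapsto> br c i)) V'"
      using MExNode.IH[OF g'] 1 that by blast
    then show ?thesis using c by auto
  qed
  show ?case
    using step[of N v V M R v' V'] step[of M v' V' N "R\<inverse>" v V] MExNode.prems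
      game_position_converse matching_converse by auto
next
  case (MExPath X \<phi>)
  have step: "m_sat (MExPath X \<phi>) (star AP M) v' V'"
    if sat: "m_sat (MExPath X \<phi>) (star AP N) v V" and "N \<noteq> {}" "M \<noteq> {}"
      and g: "game_position (Suc (quantifier_rank \<phi>)) N M R" and m: "matching R v v' V V'"
    for N M R v v' V V'
  proof -
    obtain b where b: "b \<in> N" and 1: "m_sat \<phi> (star AP N) v (V(X \<mapsto> range (br b)))"
      using sat \<open>N \<noteq> {}\<close> by (auto simp: Paths_star)
    obtain c R' where c: "c \<in> M" "(b, c) \<in> R'" "R \<subseteq> R'"
      and g': "game_position (quantifier_rank \<phi>) N M R'"
      using game_position_extend[OF g b] by metis
    have "matching R' v v' (V(X \<mapsto> range (br b))) (V'(X \<mapsto> range (br c)))"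
      using m c by (auto intro: matching_ExPath matching_mono)
    then have "m_sat \<phi> (star AP M) v' (V'(X \<mapsto> range (br c)))"
      using MExPath.IH[OF g'] 1 that by blast
    then show ?thesis using c \<open>M \<noteq> {}\<close> by (auto simp: Paths_star)
  qed
  show ?case
    using step[of N v V M R v' V'] step[of M v' V' N "R\<inverse>" v V] MExPath.prems
      game_position_converse matching_converse by auto
qed

text \<open>The finite star has one branch more than the rank, so it is nonempty even at rank 0 and
  the empty relation is a valid starting position.\<close>

lemma m_models_star_eq:
  "m_models (star AP {..quantifier_rank \<phi>}) \<phi> \<longleftrightarrow> m_models (star AP UNIV) \<phi>"
  unfolding m_models_def
  by (rule m_sat_star_transfer[where R = "{}"]) (auto simp: game_position_def matching_def)

end


section \<open>A HyperQCTL* formula for infinitely many branches\<close>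

text \<open>Some labeling puts \<open>q\<close> on every path, and no path has the latest first occurrence
  of \<open>q\<close>.\<close>

definition unbounded_firsts :: "'p \<Rightarrow> 'p hyperqctl" where
  "unbounded_firsts q = HExProp q (HNot (HExPath 0 (HNot (HExPath 1
     (HUntil (HNot (HAtom q 1)) (HAnd (HAtom q 0) (HNot (HAtom q 1))))))))"

lemma h_closed_unbounded_firsts: "h_closed AP (unbounded_firsts q)"
  by (auto simp: h_closed_def unbounded_firsts_def)

text \<open>Paths become branch indices, and the prefix condition at position 0 is vacuous as all
  branches share the root. The until says that \<open>q\<close> holds on \<open>b\<close> at some
  \<open>k\<close> while \<open>c\<close> is free of \<open>q\<close> up to and including
  \<open>k\<close>.\<close>

lemma (in star_branches) h_models_unbounded_firsts:
  assumes N: "N \<noteq> {}"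
  shows "h_models (star AP N) (unbounded_firsts q) \<longleftrightarrow>
    (\<exists>L. (\<forall>s\<in>nodes (star AP N). L s \<subseteq> AP \<union> {q} \<and> L s \<inter> (AP - {q}) = {}) \<and>
      (\<forall>b\<in>N. \<exists>c\<in>N. \<exists>k. q \<in> L (br b k) \<and> (\<forall>j\<le>k. q \<notin> L (br c j))))"
proof -
  have P: "Paths (star AP N\<lparr>props := A, label := L\<rparr>) = br ` N" for A L
    using Paths_star[OF N] by (subst Paths_cong[where T = "star AP N"]) auto
  have U: "q \<notin> L (br c k) \<and> (\<forall>j<k. q \<notin> L (br c j)) \<longleftrightarrow> (\<forall>j\<le>k. q \<notin> L (br c j))"
    for L c k
    by (auto simp: le_less)
  show ?thesis
    by (simp add: h_models_def unbounded_firsts_def P br_eq_iff U)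
qed

lemma (in star_branches) finite_star_unbounded_firsts:
  assumes N: "N \<noteq> {}" "finite N"
  shows "\<not> h_models (star AP N) (unbounded_firsts q)"
proof
  assume "h_models (star AP N) (unbounded_firsts q)"
  then obtain L where L: "\<forall>b\<in>N. \<exists>c\<in>N. \<exists>k. q \<in> L (br b k) \<and> (\<forall>j\<le>k. q \<notin> L (br c j))"
    unfolding h_models_unbounded_firsts[OF N(1)] by (elim exE conjE)
  \<comment> \<open>The first level carrying \<open>q\<close> on branch \<open>b\<close>. It would
    strictly increase from \<open>b\<close> to a suitable \<open>c\<close>, which is impossible when
    \<open>N\<close> is finite.\<close>
  define f where "f b = (LEAST k. q \<in> L (br b k))" for b
  have later: "\<exists>c\<in>N. f b < f c" if b: "b \<in> N" for b
  proof -
    obtain c k where c: "c \<in> N" and k: "q \<in> L (br b k)" "\<forall>j\<le>k. q \<notin> L (br c j)"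
      using L b by blast
    \<comment> \<open>The condition applied to \<open>c\<close> itself shows that \<open>q\<close>
      occurs on that branch, so the least level is attained.\<close>
    obtain l where "q \<in> L (br c l)" using L c by blast
    then have "q \<in> L (br c (f c))" unfolding f_def by (rule LeastI)
    then have "k < f c" using k(2) by (meson not_le)
    moreover have "f b \<le> k" using k(1) by (simp add: f_def Least_le)
    ultimately show ?thesis using c by (meson le_less_trans)
  qed
  have "Max (f ` N) \<in> f ` N" using N by simp
  then obtain b where "b \<in> N" "f b = Max (f ` N)" by auto
  then obtain c where "c \<in> N" "Max (f ` N) < f c" using later by metis
  then show False using N by (simp add: not_le[symmetric])
qed

lemma (in star_branches) infinite_star_unbounded_firsts:
  "h_models (star AP UNIV) (unbounded_firsts q)"
proof -
  \<comment> \<open>Branch \<open>b\<close> is marked only at level \<open>Suc b\<close>. The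
    successor avoids level 0, where a mark would lie on every branch at once; branch
    \<open>Suc b\<close> then answers branch \<open>b\<close>.\<close>
  define L where "L s = (if \<exists>b. s = br b (Suc b) then {q} else {})" for s
  have "q \<in> L (br b (Suc b)) \<and> (\<forall>j\<le>Suc b. q \<notin> L (br (Suc b) j))" for b
    by (auto simp: L_def br_eq_iff)
  then have "\<forall>b\<in>UNIV. \<exists>c\<in>UNIV. \<exists>k. q \<in> L (br b k) \<and> (\<forall>j\<le>k. q \<notin> L (br c j))" by blast
  moreover have "\<forall>s\<in>nodes (star AP UNIV). L s \<subseteq> AP \<union> {q} \<and> L s \<inter> (AP - {q}) = {}"
    by (simp add: L_def)
  ultimately show ?thesis
    unfolding h_models_unbounded_firsts[OF UNIV_not_empty] by blast
qed

section \<open>Existence of stars and conclusion\<close>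

lemma star_branches_exist:
  assumes "infinite (UNIV :: 's set)"
  obtains br :: "nat \<Rightarrow> nat \<Rightarrow> 's" where "star_branches br"
proof -
  obtain g :: "nat \<Rightarrow> 's" where "inj g" using infinite_countable_subset[OF assms] by auto
  \<comment> \<open>Pairs of branch and level are coded injectively; replacing the branch by 0 at
    level 0 identifies all roots.\<close>
  then have "star_branches (\<lambda>b i. g (prod_encode (if i = 0 then 0 else b, i)))"
    by unfold_locales (auto simp: inj_eq inj_eq[OF inj_prod_encode])
  then show thesis by (rule that)
qed

theorem theorem4:
  fixes AP :: "'p set"
  assumes "infinite (UNIV :: 'p set)"
    and "infinite (UNIV :: 's set)"
  shows "(\<forall>\<phi>. m_sentence AP \<phi> \<longrightarrow>
            (\<exists>\<psi>. h_closed AP \<psi> \<and>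
               (\<forall>T :: ('s, 'p) ltree. labeled_tree AP T \<and> all_nodes_on_paths T \<longrightarrow>
                  (m_models T \<phi> \<longleftrightarrow> h_models T \<psi>)))) \<and>
         (\<exists>\<psi>. h_closed AP \<psi> \<and>
            \<not> (\<exists>\<phi>. m_sentence AP \<phi> \<and>
                 (\<forall>T :: ('s, 'p) ltree. labeled_tree AP T \<and> all_nodes_on_paths T \<longrightarrow>
                    (m_models T \<phi> \<longleftrightarrow> h_models T \<psi>))))"
proof (rule conjI[rotated])
  obtain br :: "nat \<Rightarrow> nat \<Rightarrow> 's" where "star_branches br"
    using star_branches_exist[OF assms(2)] .
  then interpret star_branches br .
  \<comment> \<open>Any proposition will do, in \<open>AP\<close> or not, since the formula binds
    it.\<close>
  fix q :: 'p
  have "\<not> (\<forall>T :: ('s, 'p) ltree. labeled_tree AP T \<and> all_nodes_on_paths T \<longrightarrow>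
      (m_models T \<phi> \<longleftrightarrow> h_models T (unbounded_firsts q)))" for \<phi>
  proof
    assume eq: "\<forall>T :: ('s, 'p) ltree. labeled_tree AP T \<and> all_nodes_on_paths T \<longrightarrow>
      (m_models T \<phi> \<longleftrightarrow> h_models T (unbounded_firsts q))"
    have "m_models (star AP N) \<phi> \<longleftrightarrow> h_models (star AP N) (unbounded_firsts q)"
      if "N \<noteq> {}" for N
      using eq labeled_tree_star[OF that] all_nodes_on_paths_star[OF that] by blast
    \<comment> \<open>An equivalent \<open>\<phi>\<close> would be false on the star with
      \<open>Suc (quantifier_rank \<phi>)\<close> branches and true on the infinite one, against
      \<open>m_models_star_eq\<close>.\<close>
    then show False
      using finite_star_unbounded_firsts infinite_star_unbounded_firsts m_models_star_eq
      by (metis UNIV_not_empty finite_atMost not_empty_eq_Iic_eq_empty)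
  qed
  then show "\<exists>\<psi>. h_closed AP \<psi> \<and>
      \<not> (\<exists>\<phi>. m_sentence AP \<phi> \<and>
           (\<forall>T :: ('s, 'p) ltree. labeled_tree AP T \<and> all_nodes_on_paths T \<longrightarrow>
              (m_models T \<phi> \<longleftrightarrow> h_models T \<psi>)))"
    using h_closed_unbounded_firsts[of AP q] by (intro exI[of _ "unbounded_firsts q"]) simp
qed (intro allI impI mpl_to_hyperqctl[OF assms(1)])

end
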